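(* Let $R$ be a weakly small associative ring and let $J$ be its Jacobson radical. For every finite tuple $a$ of elements of $J$, the algebraic closure $\Gamma$ of $a$ in $J$ (that is, $\Gamma=\mathrm{acl}(a)\cap J$) is a nilpotent ring: there is a natural number $n\ge 1$ such that every product $r_1\cdots r_n$ of $n$ elements of $\Gamma$ is zero.
   Context: Rings are associative, not necessarily unitary nor commutative, and may carry extra first-order structure. A first-order structure $M$ is weakly small if for every finite subset $A$ of $M$ there are only countably many complete $1$-types over $A$. $\mathrm{acl}$ denotes model-theoretic algebraic closure. An element $r$ of a ring is right quasi-regular if there is $s$ with $r+s+rs=0$. The Jacobson radical of a ring is the unique maximal right ideal all of whose elements are right quasi-regular; it is definable by the formula $\forall y\,\exists z\,(xy+z+xyz=0)$. *)

theory Defs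
  imports Complex_Main "HOL-Library.Countable_Set"
begin

section \<open>First-order structures\<close>

text \<open>
  The universe of a structure is the whole type \<open>'a\<close>. A symbol of arity \<open>None\<close> does not belong to
  the language; this is needed because HOL types of symbols are never empty, whereas a language may
  have no symbols of a given kind. Interpretations matter only on lists of the right length.
  No bound is put on the cardinality of the language.
\<close>

record ('f, 'r, 'a) fo_structure =
  fun_arity :: "'f \<Rightarrow> nat option"
  rel_arity :: "'r \<Rightarrow> nat option"
  fun_interp :: "'f \<Rightarrow> 'a list \<Rightarrow> 'a"
  rel_interp :: "'r \<Rightarrow> 'a list \<Rightarrow> bool"

text \<open>
  \<open>Param a\<close> is the constant naming the element \<open>a\<close>, so that formulas with
  \<open>fm_params \<phi> \<subseteq> A\<close> are the formulas of the language expanded by names for the elements of \<open>A\<close>.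
\<close>

datatype (tm_funs: 'f, tm_params: 'a) tm =
  Var nat
| Param 'a
| Fun 'f "('f, 'a) tm list"

datatype (fm_funs: 'f, fm_rels: 'r, fm_params: 'a) fm =
  Eq "('f, 'a) tm" "('f, 'a) tm"
| Rel 'r "('f, 'a) tm list"
| Neg "('f, 'r, 'a) fm"
| Conj "('f, 'r, 'a) fm" "('f, 'r, 'a) fm"
| Ex nat "('f, 'r, 'a) fm"

fun wf_tm :: "('f, 'r, 'a) fo_structure \<Rightarrow> ('f, 'a) tm \<Rightarrow> bool" where
  "wf_tm M (Var i) \<longleftrightarrow> True"
| "wf_tm M (Param a) \<longleftrightarrow> True"
| "wf_tm M (Fun f ts) \<longleftrightarrow> fun_arity M f = Some (length ts) \<and> (\<forall>t\<in>set ts. wf_tm M t)"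

fun wf_fm :: "('f, 'r, 'a) fo_structure \<Rightarrow> ('f, 'r, 'a) fm \<Rightarrow> bool" where
  "wf_fm M (Eq s t) \<longleftrightarrow> wf_tm M s \<and> wf_tm M t"
| "wf_fm M (Rel r ts) \<longleftrightarrow> rel_arity M r = Some (length ts) \<and> (\<forall>t\<in>set ts. wf_tm M t)"
| "wf_fm M (Neg \<phi>) \<longleftrightarrow> wf_fm M \<phi>"
| "wf_fm M (Conj \<phi> \<psi>) \<longleftrightarrow> wf_fm M \<phi> \<and> wf_fm M \<psi>"
| "wf_fm M (Ex i \<phi>) \<longleftrightarrow> wf_fm M \<phi>"

fun fv_tm :: "('f, 'a) tm \<Rightarrow> nat set" where
  "fv_tm (Var i) = {i}"
| "fv_tm (Param a) = {}"
| "fv_tm (Fun f ts) = (\<Union>t\<in>set ts. fv_tm t)"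

fun fv_fm :: "('f, 'r, 'a) fm \<Rightarrow> nat set" where
  "fv_fm (Eq s t) = fv_tm s \<union> fv_tm t"
| "fv_fm (Rel r ts) = (\<Union>t\<in>set ts. fv_tm t)"
| "fv_fm (Neg \<phi>) = fv_fm \<phi>"
| "fv_fm (Conj \<phi> \<psi>) = fv_fm \<phi> \<union> fv_fm \<psi>"
| "fv_fm (Ex i \<phi>) = fv_fm \<phi> - {i}"

fun eval_tm :: "('f, 'r, 'a) fo_structure \<Rightarrow> (nat \<Rightarrow> 'a) \<Rightarrow> ('f, 'a) tm \<Rightarrow> 'a" where
  "eval_tm M e (Var i) = e i"
| "eval_tm M e (Param a) = a"
| "eval_tm M e (Fun f ts) = fun_interp M f (map (eval_tm M e) ts)"

fun sat :: "('f, 'r, 'a) fo_structure \<Rightarrow> (nat \<Rightarrow> 'a) \<Rightarrow> ('f, 'r, 'a) fm \<Rightarrow> bool" where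
  "sat M e (Eq s t) \<longleftrightarrow> eval_tm M e s = eval_tm M e t"
| "sat M e (Rel r ts) \<longleftrightarrow> rel_interp M r (map (eval_tm M e) ts)"
| "sat M e (Neg \<phi>) \<longleftrightarrow> \<not> sat M e \<phi>"
| "sat M e (Conj \<phi> \<psi>) \<longleftrightarrow> sat M e \<phi> \<and> sat M e \<psi>"
| "sat M e (Ex i \<phi>) \<longleftrightarrow> (\<exists>x. sat M (e(i := x)) \<phi>)"

definition formulas1 :: "('f, 'r, 'a) fo_structure \<Rightarrow> 'a set \<Rightarrow> ('f, 'r, 'a) fm set" where
  "formulas1 M A = {\<phi>. wf_fm M \<phi> \<and> fm_params \<phi> \<subseteq> A \<and> fv_fm \<phi> \<subseteq> {0}}"

text \<open>
  For \<open>\<phi> \<in> formulas1 M A\<close> only the value of variable 0 matters, hence the constant assignment.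
\<close>

definition holds1 :: "('f, 'r, 'a) fo_structure \<Rightarrow> ('f, 'r, 'a) fm \<Rightarrow> 'a \<Rightarrow> bool" where
  "holds1 M \<phi> x \<longleftrightarrow> sat M (\<lambda>_. x) \<phi>"

text \<open>
  Complete 1-types over \<open>A\<close> in the sense of the theory of \<open>M\<close> with names for \<open>A\<close>: they are
  finitely satisfiable in \<open>M\<close>, but need not be realised in \<open>M\<close>.
\<close>

definition complete_1types ::
    "('f, 'r, 'a) fo_structure \<Rightarrow> 'a set \<Rightarrow> ('f, 'r, 'a) fm set set" where
  "complete_1types M A =
    {p. p \<subseteq> formulas1 M A \<and>
        (\<forall>F. finite F \<and> F \<subseteq> p \<longrightarrow> (\<exists>x. \<forall>\<phi>\<in>F. holds1 M \<phi> x)) \<and>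
        (\<forall>\<phi>\<in>formulas1 M A. \<phi> \<in> p \<or> Neg \<phi> \<in> p)}"

definition weakly_small :: "('f, 'r, 'a) fo_structure \<Rightarrow> bool" where
  "weakly_small M \<longleftrightarrow> (\<forall>A. finite A \<longrightarrow> countable (complete_1types M A))"

definition acl :: "('f, 'r, 'a) fo_structure \<Rightarrow> 'a set \<Rightarrow> 'a set" where
  "acl M A = {b. \<exists>\<phi>\<in>formulas1 M A. finite {x. holds1 M \<phi> x} \<and> holds1 M \<phi> b}"


section \<open>Rings with extra structure\<close>

text \<open>The type class \<open>ring\<close> is that of associative rings, without unit or commutativity.\<close>

datatype 'f ring_fun = RZero | RUminus | RPlus | RTimes | Extra 'f

text \<open>
  The ring \<open>'a\<close> as a structure in the language of rings enlarged by the symbols of the extra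
  structure \<open>X\<close> on the same universe.
\<close>

definition ring_structure ::
    "('f, 'r, 'a::ring) fo_structure \<Rightarrow> ('f ring_fun, 'r, 'a) fo_structure" where
  "ring_structure X =
    \<lparr> fun_arity = (\<lambda>s. case s of RZero \<Rightarrow> Some 0 | RUminus \<Rightarrow> Some 1 | RPlus \<Rightarrow> Some 2
                       | RTimes \<Rightarrow> Some 2 | Extra f \<Rightarrow> fun_arity X f),
      rel_arity = rel_arity X,
      fun_interp = (\<lambda>s xs. case s of RZero \<Rightarrow> 0 | RUminus \<Rightarrow> - (xs ! 0)
                       | RPlus \<Rightarrow> xs ! 0 + xs ! 1 | RTimes \<Rightarrow> xs ! 0 * xs ! 1
                       | Extra f \<Rightarrow> fun_interp X f xs),
      rel_interp = rel_interp X \<rparr>"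

definition subring :: "'a::ring set \<Rightarrow> bool" where
  "subring S \<longleftrightarrow> 0 \<in> S \<and> (\<forall>x\<in>S. \<forall>y\<in>S. x + y \<in> S \<and> - x \<in> S \<and> x * y \<in> S)"

definition right_ideal :: "'a::ring set \<Rightarrow> bool" where
  "right_ideal I \<longleftrightarrow>
    0 \<in> I \<and> (\<forall>x\<in>I. \<forall>y\<in>I. x + y \<in> I) \<and> (\<forall>x\<in>I. - x \<in> I) \<and> (\<forall>x\<in>I. \<forall>y. x * y \<in> I)"

definition right_quasi_regular :: "'a::ring \<Rightarrow> bool" where
  "right_quasi_regular r \<longleftrightarrow> (\<exists>s. r + s + r * s = 0)"

definition quasi_regular_right_ideal :: "'a::ring set \<Rightarrow> bool" where
  "quasi_regular_right_ideal I \<longleftrightarrow> right_ideal I \<and> (\<forall>r\<in>I. right_quasi_regular r)"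

text \<open>
  Maximality is among the right ideals consisting of right quasi-regular elements; the radical may
  be the whole ring. Existence and uniqueness are shown below.
\<close>

definition is_jacobson_radical :: "'a::ring set \<Rightarrow> bool" where
  "is_jacobson_radical J \<longleftrightarrow> quasi_regular_right_ideal J \<and>
    (\<forall>I. quasi_regular_right_ideal I \<and> J \<subseteq> I \<longrightarrow> I = J)"

definition jacobson_radical :: "'a::ring set" where
  "jacobson_radical = (THE J. is_jacobson_radical J)"

lemma right_quasi_regular_circ:
  fixes x s :: "'a::ring"
  assumes "right_quasi_regular (x + s + x * s)"
  shows "right_quasi_regular x"
proof -
  obtain t where t: "(x + s + x * s) + t + (x + s + x * s) * t = 0"
    using assms unfolding right_quasi_regular_def by blast
  have "x + (s + t + s * t) + x * (s + t + s * t) = 0"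
    using t by (simp add: algebra_simps)
  then show ?thesis unfolding right_quasi_regular_def by blast
qed

lemma quasi_regular_right_ideal_greatest:
  defines "Q \<equiv> {x::'a::ring. \<forall>y. right_quasi_regular (x * y)}"
  shows "quasi_regular_right_ideal Q"
    and "quasi_regular_right_ideal I \<Longrightarrow> I \<subseteq> Q"
proof -
  have reg: "right_quasi_regular x" if "x \<in> Q" for x
  proof -
    have "right_quasi_regular (x * (- x))" using that unfolding Q_def by blast
    then have "right_quasi_regular (x + (- x) + x * (- x))" by simp
    then show ?thesis by (rule right_quasi_regular_circ)
  qed
  have mult: "x * y \<in> Q" if "x \<in> Q" for x y
    using that unfolding Q_def by (simp add: mult.assoc)
  have summand: "right_quasi_regular (u + v)" if u: "u \<in> Q" and v: "v \<in> Q" for u v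
  proof -
    obtain s where s: "u + s + u * s = 0"
      using reg[OF u] unfolding right_quasi_regular_def by blast
    have "v + v * s \<in> Q"
      unfolding Q_def
    proof (intro CollectI allI)
      fix w
      have "(v + v * s) * w = v * (w + s * w)" by (simp add: algebra_simps)
      then show "right_quasi_regular ((v + v * s) * w)" using v unfolding Q_def by simp
    qed
    moreover have "(u + v) + s + (u + v) * s = (u + s + u * s) + (v + v * s)"
      by (simp add: algebra_simps)
    then have "(u + v) + s + (u + v) * s = v + v * s" using s by (simp only: add_0_left)
    ultimately have "right_quasi_regular ((u + v) + s + (u + v) * s)" using reg by metis
    then show ?thesis by (rule right_quasi_regular_circ)
  qed
  have zero: "0 \<in> Q" unfolding Q_def right_quasi_regular_def by auto
  have add: "x + y \<in> Q" if "x \<in> Q" "y \<in> Q" for x y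
    using summand[OF mult mult, OF that] unfolding Q_def by (simp add: distrib_right)
  have minus: "- x \<in> Q" if "x \<in> Q" for x
    unfolding Q_def
  proof (intro CollectI allI)
    fix y
    have "- x * y = x * (- y)" by simp
    then show "right_quasi_regular (- x * y)" using that unfolding Q_def by (metis mem_Collect_eq)
  qed
  show "quasi_regular_right_ideal Q"
    unfolding quasi_regular_right_ideal_def right_ideal_def
    using zero add minus mult reg by blast
  show "I \<subseteq> Q" if "quasi_regular_right_ideal I"
    using that unfolding Q_def quasi_regular_right_ideal_def right_ideal_def by blast
qed

lemma is_jacobson_radical_iff:
  "is_jacobson_radical J \<longleftrightarrow> J = {x::'a::ring. \<forall>y. right_quasi_regular (x * y)}"
  unfolding is_jacobson_radical_def
  using quasi_regular_right_ideal_greatest[where 'a = 'a] by blast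

lemma jacobson_radical_eq:
  "jacobson_radical = {x::'a::ring. \<forall>y. \<exists>z. x * y + z + x * y * z = 0}"
  unfolding jacobson_radical_def is_jacobson_radical_iff right_quasi_regular_def by simp

text \<open>
  There is no empty product in a ring without unit, so \<open>ring_prod\<close> is meaningful on nonempty
  lists only.
\<close>

fun ring_prod :: "'a::ring list \<Rightarrow> 'a" where
  "ring_prod [] = undefined"
| "ring_prod (r # rs) = foldl (*) r rs"

definition nilpotent_subring :: "'a::ring set \<Rightarrow> bool" where
  "nilpotent_subring S \<longleftrightarrow> subring S \<and>
    (\<exists>n\<ge>1. \<forall>rs. length rs = n \<and> set rs \<subseteq> S \<longrightarrow> ring_prod rs = 0)"

end

theory Submission imports Defs begin

text \<open>
  Weak smallness enters through one chain condition (\<open>trace_chain_condition\<close>): a descending chain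
  of \<open>A\<close>-definable additive subgroups becomes stationary somewhere when it is intersected with
  \<open>acl(A)\<close>, for finite \<open>A\<close>. If it did not, then for every finite \<open>A\<close>-definable set \<open>D\<close> and
  subgroup \<open>H\<close> of the chain, the set \<open>D + H\<close> would contain two disjoint sets of the same
  form, \<open>D + H'\<close> and \<open>D' + H'\<close> with \<open>H'\<close> further down the chain, and such a
  perfect tree of \<open>A\<close>-definable sets yields uncountably many types over \<open>A\<close>.

  First consequence: a finite subset \<open>D\<close> of the radical \<open>J\<close> generates a nilpotent ring
  (\<open>finite_subset_of_radical_nilpotent\<close>). Put \<open>H\<^sub>0 = J\<close> and let \<open>H\<^sub>n\<^sub>+\<^sub>1\<close> be the sum of the \<open>d H\<^sub>n\<close>
  with \<open>d\<close> in \<open>D\<close>. These subgroups are definable over \<open>D\<close>, and where their traces become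
  stationary the finite set \<open>W = D\<^sup>n\<^sup>+\<^sup>1\<close> of products lies in \<open>W J\<close>, so that \<open>W\<close> vanishes
  by the argument of Nakayama's lemma.

  Second consequence: if a subset \<open>S\<close> of \<open>\<Gamma>\<close> is a union of finite \<open>A\<close>-definable sets, then
  its left and its right annihilator in \<open>\<Gamma>\<close> are annihilators of finite subsets of \<open>S\<close>
  (\<open>annihilator_finitely_determined\<close>). Applied on one side it shows that the left annihilators of the
  powers \<open>\<Gamma>\<^sup>n\<close> stop growing, say at \<open>L = ann(\<Gamma>\<^sup>m)\<close>. Applied on the other side to \<open>\<Gamma>\<^sup>2\<^sup>m\<close>,
  whose annihilator is \<open>L\<close> as well, it gives a finite \<open>F\<close> inside \<open>\<Gamma>\<close> such that
  \<open>x F \<subseteq> L\<close> forces \<open>x \<in> L\<close>. Iterating, \<open>x F\<^sup>k \<subseteq> L\<close> forces \<open>x \<in> L\<close>; but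
  \<open>F\<^sup>k\<close> is zero for some \<open>k\<close> by the first consequence. So \<open>\<Gamma> = L\<close>, which says
  \<open>\<Gamma>\<^sup>m\<^sup>+\<^sup>1 = 0\<close>.

  Everything is arranged to use subgroups definable over \<open>A\<close> itself and not merely over
  \<open>acl(A)\<close>: a finite subset of \<open>acl(A)\<close> is enlarged to a finite \<open>A\<close>-definable one, by
  means of the smallest definable set around each of its points (\<open>locus\<close>).
\<close>

section \<open>Definable sets and complete types\<close>

definition definable_set :: "('f, 'r, 'a) fo_structure \<Rightarrow> 'a set \<Rightarrow> 'a set \<Rightarrow> bool" where
  "definable_set M A X \<longleftrightarrow> (\<exists>\<phi>\<in>formulas1 M A. X = {x. holds1 M \<phi> x})"

lemma eval_tm_cong: "(\<And>i. i \<in> fv_tm t \<Longrightarrow> e i = e' i) \<Longrightarrow> eval_tm M e t = eval_tm M e' t"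
proof (induction t)
  case (Fun f ts)
  have "map (eval_tm M e) ts = map (eval_tm M e') ts"
  proof (rule map_cong[OF refl])
    fix t assume "t \<in> set ts"
    then show "eval_tm M e t = eval_tm M e' t"
      by (rule Fun.IH) (rule Fun.prems, use \<open>t \<in> set ts\<close> in auto)
  qed
  then show ?case by (simp only: eval_tm.simps)
qed auto

lemma sat_cong: "(\<And>i. i \<in> fv_fm \<phi> \<Longrightarrow> e i = e' i) \<Longrightarrow> sat M e \<phi> = sat M e' \<phi>"
proof (induction \<phi> arbitrary: e e')
  case (Eq s t)
  have "eval_tm M e s = eval_tm M e' s" by (rule eval_tm_cong, rule Eq) simp
  moreover have "eval_tm M e t = eval_tm M e' t" by (rule eval_tm_cong, rule Eq) simp
  ultimately show ?case by (simp only: sat.simps)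
next
  case (Rel r ts)
  have "map (eval_tm M e) ts = map (eval_tm M e') ts"
    by (rule map_cong[OF refl], rule eval_tm_cong, rule Rel) auto
  then show ?case by (simp only: sat.simps)
next
  case (Neg \<phi>)
  have "sat M e \<phi> = sat M e' \<phi>" by (rule Neg.IH, rule Neg.prems) simp
  then show ?case by (simp only: sat.simps)
next
  case (Conj \<phi> \<psi>)
  have "sat M e \<phi> = sat M e' \<phi>" by (rule Conj.IH(1), rule Conj.prems) simp
  moreover have "sat M e \<psi> = sat M e' \<psi>" by (rule Conj.IH(2), rule Conj.prems) simp
  ultimately show ?case by (simp only: sat.simps)
next
  case (Ex i \<phi>)
  have "(e(i := x)) j = (e'(i := x)) j" if "j \<in> fv_fm \<phi>" for x j
    using Ex.prems[of j] that by (cases "j = i") auto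
  then have "sat M (e(i := x)) \<phi> = sat M (e'(i := x)) \<phi>" for x by (rule Ex.IH)
  then show ?case by (simp only: sat.simps)
qed

lemma sat_iff_holds1: "\<phi> \<in> formulas1 M A \<Longrightarrow> sat M e \<phi> \<longleftrightarrow> holds1 M \<phi> (e 0)"
  unfolding holds1_def by (rule sat_cong) (auto simp: formulas1_def)

lemma definable_set_Int:
  assumes "definable_set M A X" "definable_set M A Y"
  shows "definable_set M A (X \<inter> Y)"
proof -
  obtain \<phi> \<psi> where "\<phi> \<in> formulas1 M A" "X = {x. holds1 M \<phi> x}"
    "\<psi> \<in> formulas1 M A" "Y = {x. holds1 M \<psi> x}"
    using assms unfolding definable_set_def by blast
  then show ?thesis unfolding definable_set_def
    by (intro bexI[of _ "Conj \<phi> \<psi>"]) (auto simp: holds1_def formulas1_def)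
qed

lemma definable_set_Compl:
  assumes "definable_set M A X"
  shows "definable_set M A (- X)"
proof -
  obtain \<phi> where "\<phi> \<in> formulas1 M A" "X = {x. holds1 M \<phi> x}"
    using assms unfolding definable_set_def by blast
  then show ?thesis unfolding definable_set_def
    by (intro bexI[of _ "Neg \<phi>"]) (auto simp: holds1_def formulas1_def)
qed

lemma definable_set_Diff:
  assumes "definable_set M A X" "definable_set M A Y"
  shows "definable_set M A (X - Y)"
  using definable_set_Int[OF assms(1) definable_set_Compl[OF assms(2)]] by (simp add: Diff_eq)

lemma definable_set_Un:
  assumes "definable_set M A X" "definable_set M A Y"
  shows "definable_set M A (X \<union> Y)"
  using definable_set_Compl[OF definable_set_Int[OF definable_set_Compl[OF assms(1)]
    definable_set_Compl[OF assms(2)]]] by simp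

lemma definable_set_singleton: "a \<in> A \<Longrightarrow> definable_set M A {a}"
  unfolding definable_set_def
  by (intro bexI[of _ "Eq (Var 0) (Param a)"]) (auto simp: holds1_def formulas1_def)

lemma definable_set_UNIV: "definable_set M A UNIV"
  unfolding definable_set_def
  by (intro bexI[of _ "Eq (Var 0) (Var 0)"]) (auto simp: holds1_def formulas1_def)

lemma definable_set_empty: "definable_set M A {}"
  using definable_set_Compl[OF definable_set_UNIV] by simp

lemma mem_acl_iff: "b \<in> acl M A \<longleftrightarrow> (\<exists>X. definable_set M A X \<and> finite X \<and> b \<in> X)"
  unfolding acl_def definable_set_def by auto

text \<open>
  A maximal finitely satisfiable set of formulas is complete: a formula and its negation cannot both
  be refuted by finite subsets.
\<close>

lemma complete_type_extending:
  assumes "p0 \<subseteq> formulas1 M A"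
    and "\<And>F. finite F \<Longrightarrow> F \<subseteq> p0 \<Longrightarrow> \<exists>x. \<forall>\<phi>\<in>F. holds1 M \<phi> x"
  shows "\<exists>p\<in>complete_1types M A. p0 \<subseteq> p"
proof -
  define Q where "Q = {p. p0 \<subseteq> p \<and> p \<subseteq> formulas1 M A \<and>
    (\<forall>F. finite F \<and> F \<subseteq> p \<longrightarrow> (\<exists>x. \<forall>\<phi>\<in>F. holds1 M \<phi> x))}"
  have "p0 \<in> Q" unfolding Q_def using assms by blast
  moreover have "\<Union>C \<in> Q" if C: "C \<noteq> {}" "subset.chain Q C" for C
  proof -
    have sub: "C \<subseteq> Q" using C(2) unfolding subset_chain_def by blast
    have "\<exists>x. \<forall>\<phi>\<in>F. holds1 M \<phi> x" if F: "finite F" "F \<subseteq> \<Union>C" for F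
    proof -
      obtain p where "p \<in> C" "F \<subseteq> p"
        using finite_subset_Union_chain[OF F C] by blast
      then show ?thesis using sub F(1) unfolding Q_def by blast
    qed
    moreover have "p0 \<subseteq> \<Union>C" using sub C(1) unfolding Q_def by fast
    moreover have "\<Union>C \<subseteq> formulas1 M A" using sub unfolding Q_def by fast
    ultimately show ?thesis unfolding Q_def by simp
  qed
  ultimately obtain p where p: "p \<in> Q" and max: "\<And>q. q \<in> Q \<Longrightarrow> p \<subseteq> q \<Longrightarrow> q = p"
    using subset_Zorn_nonempty[of Q] by blast
  have fin: "\<exists>x. \<forall>\<phi>\<in>F. holds1 M \<phi> x" if "finite F" "F \<subseteq> p" for F
    using p that unfolding Q_def by blast
  have refutation: "\<exists>F. finite F \<and> F \<subseteq> p \<and> (\<forall>x. holds1 M \<phi> x \<longrightarrow> \<not> (\<forall>\<psi>\<in>F. holds1 M \<psi> x))"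
    if \<phi>: "\<phi> \<in> formulas1 M A" "\<phi> \<notin> p" for \<phi>
  proof -
    have "insert \<phi> p \<notin> Q" using max[of "insert \<phi> p"] \<phi>(2) by blast
    then obtain F where F: "finite F" "F \<subseteq> insert \<phi> p" "\<not> (\<exists>x. \<forall>\<psi>\<in>F. holds1 M \<psi> x)"
      using p \<phi>(1) unfolding Q_def by blast
    then show ?thesis by (intro exI[of _ "F - {\<phi>}"]) auto
  qed
  have "\<phi> \<in> p \<or> Neg \<phi> \<in> p" if \<phi>: "\<phi> \<in> formulas1 M A" for \<phi>
  proof (rule ccontr)
    assume neg: "\<not> (\<phi> \<in> p \<or> Neg \<phi> \<in> p)"
    have "Neg \<phi> \<in> formulas1 M A" using \<phi> unfolding formulas1_def by simp
    then obtain F G where "finite F" "F \<subseteq> p" "finite G" "G \<subseteq> p"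
      and FG: "\<forall>x. holds1 M \<phi> x \<longrightarrow> \<not> (\<forall>\<psi>\<in>F. holds1 M \<psi> x)"
        "\<forall>x. holds1 M (Neg \<phi>) x \<longrightarrow> \<not> (\<forall>\<psi>\<in>G. holds1 M \<psi> x)"
      using refutation[of \<phi>] refutation[of "Neg \<phi>"] \<phi> neg by blast
    then obtain x where "\<forall>\<psi>\<in>F \<union> G. holds1 M \<psi> x" using fin[of "F \<union> G"] by blast
    then show False using FG unfolding holds1_def by auto
  qed
  then have "p \<in> complete_1types M A"
    using p unfolding complete_1types_def Q_def by blast
  then show ?thesis using p unfolding Q_def by blast
qed

text \<open>
  Diagonalisation: against a given sequence of types one descends through the family, choosing at
  step \<open>n\<close> a half that is not in the \<open>n\<close>-th type; two disjoint halves cannot both belong to it.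
  A type containing the whole branch is then missing from the sequence.
\<close>

lemma uncountable_types_of_splitting_family:
  assumes "U0 \<in> \<U>"
    and definable: "\<And>U. U \<in> \<U> \<Longrightarrow> definable_set M A U"
    and nonempty: "\<And>U. U \<in> \<U> \<Longrightarrow> U \<noteq> {}"
    and split: "\<And>U. U \<in> \<U> \<Longrightarrow> \<exists>V\<in>\<U>. \<exists>W\<in>\<U>. V \<subseteq> U \<and> W \<subseteq> U \<and> V \<inter> W = {}"
  shows "uncountable (complete_1types M A)"
proof -
  have "complete_1types M A \<noteq> {}" using complete_type_extending[of "{}" M A] by auto
  moreover have False if p: "range p = complete_1types M A" for p :: "nat \<Rightarrow> _"
  proof -
    have avoid: "\<exists>V. V \<in> \<U> \<and> V \<subseteq> U \<and> (\<forall>\<phi>\<in>p n. {x. holds1 M \<phi> x} \<noteq> V)" if in_family: "U \<in> \<U>" for U n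
    proof (rule ccontr)
      assume neg: "\<not> ?thesis"
      obtain V W where VW: "V \<in> \<U>" "W \<in> \<U>" "V \<subseteq> U" "W \<subseteq> U" "V \<inter> W = {}"
        using split[OF in_family] by blast
      have "\<exists>\<phi>\<in>p n. {x. holds1 M \<phi> x} = V'" if "V' \<in> \<U>" "V' \<subseteq> U" for V'
        using neg that by simp
      then obtain \<phi> \<psi> where pq: "\<phi> \<in> p n" "{x. holds1 M \<phi> x} = V" "\<psi> \<in> p n" "{x. holds1 M \<psi> x} = W"
        using VW(1-4) by meson
      have "p n \<in> complete_1types M A" using p by blast
      then have "finite F \<and> F \<subseteq> p n \<longrightarrow> (\<exists>x. \<forall>\<chi>\<in>F. holds1 M \<chi> x)" for F
        unfolding complete_1types_def by blast
      from this[of "{\<phi>, \<psi>}"] have "\<exists>x. \<forall>\<chi>\<in>{\<phi>, \<psi>}. holds1 M \<chi> x"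
        using pq(1,3) by simp
      then show False using pq VW(5) by blast
    qed
    have "\<exists>U. \<forall>n. U n \<in> \<U> \<and>
        (U (Suc n) \<subseteq> U n \<and> (\<forall>\<phi>\<in>p n. {x. holds1 M \<phi> x} \<noteq> U (Suc n)))"
      by (rule dependent_nat_choice) (use assms(1) avoid in blast)+
    then obtain U where U: "\<And>n. U n \<in> \<U>" "\<And>n. U (Suc n) \<subseteq> U n"
      "\<And>n. \<forall>\<phi>\<in>p n. {x. holds1 M \<phi> x} \<noteq> U (Suc n)"
      by blast
    define p0 where "p0 = {\<phi> \<in> formulas1 M A. \<exists>n. {x. holds1 M \<phi> x} = U n}"
    have "\<exists>x. \<forall>\<phi>\<in>F. holds1 M \<phi> x" if F: "finite F" "F \<subseteq> p0" for F
    proof -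
      have "\<forall>\<phi>\<in>F. \<exists>n. {x. holds1 M \<phi> x} = U n" using F(2) unfolding p0_def by blast
      from bchoice[OF this] obtain k where
        k: "\<And>\<phi>. \<phi> \<in> F \<Longrightarrow> {x. holds1 M \<phi> x} = U (k \<phi>)" by blast
      define N where "N = Max (insert 0 (k ` F))"
      obtain x where "x \<in> U N" using nonempty[OF U(1)] by blast
      moreover have "U N \<subseteq> U (k \<phi>)" if "\<phi> \<in> F" for \<phi>
        using lift_Suc_antimono_le[of U, OF U(2)] F(1) that unfolding N_def by auto
      ultimately show ?thesis using k by blast
    qed
    then obtain q where q: "q \<in> complete_1types M A" "p0 \<subseteq> q"
      using complete_type_extending[of p0 M A] unfolding p0_def by auto
    have "q \<in> range p" using q(1) p by simp
    then obtain n where n: "q = p n" by auto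
    obtain \<phi> where \<phi>: "\<phi> \<in> formulas1 M A" "{x. holds1 M \<phi> x} = U (Suc n)"
      using definable[OF U(1)[of "Suc n"]] unfolding definable_set_def by auto
    then have "\<phi> \<in> p0" unfolding p0_def by auto
    then show False using n q(2) U(3)[of n] \<phi>(2) by auto
  qed
  ultimately show ?thesis unfolding uncountable_def by blast
qed

text \<open>
  For an algebraic point this is the set of realisations of its type, which is isolated. In
  general it need not be definable.
\<close>

definition locus :: "('f, 'r, 'a) fo_structure \<Rightarrow> 'a set \<Rightarrow> 'a \<Rightarrow> 'a set" where
  "locus M A x = \<Inter>{Y. definable_set M A Y \<and> x \<in> Y}"

lemma mem_locus: "x \<in> locus M A x"
  unfolding locus_def by blast

lemma locus_subset: "definable_set M A Y \<Longrightarrow> x \<in> Y \<Longrightarrow> locus M A x \<subseteq> Y"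
  unfolding locus_def by blast

text \<open>
  A finite definable set around \<open>x\<close> of least cardinality is contained in every definable set that
  contains \<open>x\<close>, since intersecting them cannot reduce its size.
\<close>

lemma locus_of_algebraic:
  assumes "x \<in> acl M A"
  shows "finite (locus M A x)" "definable_set M A (locus M A x)"
proof -
  define Q where "Q = (\<lambda>Y. definable_set M A Y \<and> finite Y \<and> x \<in> Y)"
  have "\<exists>Y. Q Y" using assms unfolding mem_acl_iff Q_def by blast
  then obtain D where D: "Q D" and min: "\<And>Y. Q Y \<Longrightarrow> card D \<le> card Y"
    using ex_has_least_nat[of Q _ card] by blast
  have "D \<subseteq> Y" if "definable_set M A Y" "x \<in> Y" for Y
  proof -
    have "Q (D \<inter> Y)" using D that definable_set_Int unfolding Q_def by blast
    then have "card D \<le> card (D \<inter> Y)" by (rule min)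
    then have "D \<inter> Y = D" using D unfolding Q_def by (intro card_seteq) auto
    then show ?thesis by blast
  qed
  then have "locus M A x = D" using D unfolding locus_def Q_def by blast
  then show "finite (locus M A x)" "definable_set M A (locus M A x)" using D unfolding Q_def by auto
qed

section \<open>Sums and products of sets, and the radical\<close>

definition set_add :: "'a::ring set \<Rightarrow> 'a set \<Rightarrow> 'a set" where
  "set_add X Y = {x + y | x y. x \<in> X \<and> y \<in> Y}"

lemma set_add_mono: "Y \<subseteq> Y' \<Longrightarrow> Z \<subseteq> Z' \<Longrightarrow> set_add Y Z \<subseteq> set_add Y' Z'"
  unfolding set_add_def by blast

definition set_mul :: "'a::ring set \<Rightarrow> 'a set \<Rightarrow> 'a set" where
  "set_mul X Y = {x * y | x y. x \<in> X \<and> y \<in> Y}"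

lemma set_mulI: "x \<in> Y \<Longrightarrow> y \<in> Z \<Longrightarrow> x * y \<in> set_mul Y Z"
  unfolding set_mul_def by blast

lemma set_mul_mono: "Y \<subseteq> Y' \<Longrightarrow> Z \<subseteq> Z' \<Longrightarrow> set_mul Y Z \<subseteq> set_mul Y' Z'"
  unfolding set_mul_def by blast

lemma set_mul_assoc: "set_mul S (set_mul T U) = set_mul (set_mul S T) (U :: 'a::ring set)"
proof (intro equalityI subsetI)
  fix u assume "u \<in> set_mul S (set_mul T U)"
  then obtain x y z where "x \<in> S" "y \<in> T" "z \<in> U" "u = x * y * z"
    unfolding set_mul_def by (auto simp: mult.assoc)
  then show "u \<in> set_mul (set_mul S T) U" unfolding set_mul_def by blast
next
  fix u assume "u \<in> set_mul (set_mul S T) U"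
  then obtain x y z where "x \<in> S" "y \<in> T" "z \<in> U" "u = x * (y * z)"
    unfolding set_mul_def by (auto simp: mult.assoc)
  then show "u \<in> set_mul S (set_mul T U)" unfolding set_mul_def by blast
qed

lemma finite_set_add: "finite Y \<Longrightarrow> finite Z \<Longrightarrow> finite (set_add Y (Z :: 'a::ring set))"
  unfolding set_add_def by (rule finite_image_set2) simp_all

lemma finite_set_mul: "finite Y \<Longrightarrow> finite Z \<Longrightarrow> finite (set_mul Y (Z :: 'a::ring set))"
  unfolding set_mul_def by (rule finite_image_set2) simp_all

definition add_subgroup :: "'a::ring set \<Rightarrow> bool" where
  "add_subgroup H \<longleftrightarrow> 0 \<in> H \<and> (\<forall>x\<in>H. \<forall>y\<in>H. x - y \<in> H)"

lemma add_subgroup_add: "add_subgroup H \<Longrightarrow> x \<in> H \<Longrightarrow> y \<in> H \<Longrightarrow> x + y \<in> H"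
  unfolding add_subgroup_def by (metis diff_0 diff_minus_eq_add)

text \<open>
  All coefficients stand on the right and come from \<open>Y\<close>; in the absence of a unit,
  \<open>W\<close> itself need not be contained in it.
\<close>

definition lincomb :: "'a::ring set \<Rightarrow> 'a set \<Rightarrow> 'a set" where
  "lincomb W Y = {\<Sum>w\<in>W. w * f w | f. \<forall>w\<in>W. f w \<in> Y}"

lemma lincombI: "(\<And>w. w \<in> W \<Longrightarrow> f w \<in> Y) \<Longrightarrow> (\<Sum>w\<in>W. w * f w) \<in> lincomb W Y"
  unfolding lincomb_def by blast

lemma lincombE:
  assumes "x \<in> lincomb W Y"
  obtains f where "x = (\<Sum>w\<in>W. w * f w)" "\<And>w. w \<in> W \<Longrightarrow> f w \<in> Y"
  using assms unfolding lincomb_def by blast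

lemma lincomb_mono: "Y \<subseteq> Y' \<Longrightarrow> lincomb W Y \<subseteq> lincomb W Y'"
  unfolding lincomb_def by blast

lemma lincomb_insert:
  assumes "finite W" "w \<notin> W"
  shows "lincomb (insert w W) Y = set_add (set_mul {w} Y) (lincomb W Y)"
proof
  show "lincomb (insert w W) Y \<subseteq> set_add (set_mul {w} Y) (lincomb W Y)"
  proof
    fix x assume "x \<in> lincomb (insert w W) Y"
    then obtain f where f: "x = (\<Sum>u\<in>insert w W. u * f u)" "\<And>u. u \<in> insert w W \<Longrightarrow> f u \<in> Y"
      by (rule lincombE) blast
    have "x = w * f w + (\<Sum>u\<in>W. u * f u)" using f(1) assms by simp
    moreover have "(\<Sum>u\<in>W. u * f u) \<in> lincomb W Y" using f(2) by (intro lincombI) auto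
    moreover have "w * f w \<in> set_mul {w} Y" using f(2) unfolding set_mul_def by auto
    ultimately show "x \<in> set_add (set_mul {w} Y) (lincomb W Y)" unfolding set_add_def by blast
  qed
  show "set_add (set_mul {w} Y) (lincomb W Y) \<subseteq> lincomb (insert w W) Y"
  proof
    fix x assume "x \<in> set_add (set_mul {w} Y) (lincomb W Y)"
    then obtain y z where x: "x = w * y + z" "y \<in> Y" "z \<in> lincomb W Y"
      unfolding set_add_def set_mul_def by blast
    obtain f where f: "z = (\<Sum>u\<in>W. u * f u)" "\<And>u. u \<in> W \<Longrightarrow> f u \<in> Y"
      using x(3) by (rule lincombE) blast
    define g where "g = f(w := y)"
    have "(\<Sum>u\<in>W. u * g u) = (\<Sum>u\<in>W. u * f u)"
      using assms(2) unfolding g_def by (intro sum.cong) auto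
    then have "x = (\<Sum>u\<in>insert w W. u * g u)"
      using x(1) f(1) assms by (simp add: g_def)
    moreover have "g u \<in> Y" if "u \<in> insert w W" for u
      using that f(2) x(2) unfolding g_def by auto
    ultimately show "x \<in> lincomb (insert w W) Y" using lincombI[of "insert w W" g Y] by simp
  qed
qed

lemma add_subgroup_lincomb:
  assumes "add_subgroup Y"
  shows "add_subgroup (lincomb W Y)"
  unfolding add_subgroup_def
proof (intro conjI ballI)
  show "0 \<in> lincomb W Y"
    using lincombI[of W "\<lambda>_. 0" Y] assms unfolding add_subgroup_def by simp
  fix x y assume "x \<in> lincomb W Y" "y \<in> lincomb W Y"
  then obtain f g where "x = (\<Sum>w\<in>W. w * f w)" "\<And>w. w \<in> W \<Longrightarrow> f w \<in> Y"
    "y = (\<Sum>w\<in>W. w * g w)" "\<And>w. w \<in> W \<Longrightarrow> g w \<in> Y"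
    by (elim lincombE) blast
  then show "x - y \<in> lincomb W Y"
    using lincombI[of W "\<lambda>w. f w - g w" Y] assms unfolding add_subgroup_def
    by (simp add: right_diff_distrib sum_subtractf)
qed

lemma mult_mem_lincomb:
  assumes "finite W" "w \<in> W" "y \<in> Y" "0 \<in> Y"
  shows "w * y \<in> lincomb W Y"
proof -
  have "(\<Sum>u\<in>W. u * (if u = w then y else 0)) = (\<Sum>u\<in>W. if u = w then u * y else 0)"
    by (intro sum.cong) auto
  then have "(\<Sum>u\<in>W. u * (if u = w then y else 0)) = w * y"
    using assms(1,2) by simp
  then show ?thesis using lincombI[of W "\<lambda>u. if u = w then y else 0" Y] assms(3,4) by simp
qed

lemma add_subgroup_sum:
  assumes "add_subgroup H" "\<And>w. w \<in> W \<Longrightarrow> f w \<in> H"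
  shows "sum f W \<in> H"
  using assms(2)
proof (induction W rule: infinite_finite_induct)
  case (insert w W)
  then show ?case using add_subgroup_add[OF assms(1)] by simp
qed (use assms(1) in \<open>auto simp: add_subgroup_def\<close>)

text \<open>
  The index is one less than the number of factors, as there is no empty product:
  \<open>set_power S n\<close> is \<open>S\<^sup>n\<^sup>+\<^sup>1\<close>.
\<close>

fun set_power :: "'a::ring set \<Rightarrow> nat \<Rightarrow> 'a set" where
  "set_power S 0 = S"
| "set_power S (Suc n) = set_mul S (set_power S n)"

lemma set_power_add: "set_power S (Suc (m + n)) = set_mul (set_power S m) (set_power S n)"
proof (induction m)
  case (Suc m)
  have "set_power S (Suc (Suc m + n)) = set_mul S (set_mul (set_power S m) (set_power S n))"
    by (simp flip: Suc)
  also have "\<dots> = set_mul (set_power S (Suc m)) (set_power S n)"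
    by (simp only: set_mul_assoc set_power.simps)
  finally show ?case .
qed simp

lemma finite_set_power: "finite S \<Longrightarrow> finite (set_power S n)"
  by (induction n) (auto simp: finite_set_mul)

lemma ring_prod_mem_set_power:
  assumes "length rs = Suc n" "set rs \<subseteq> S"
  shows "ring_prod rs \<in> set_power S n"
proof -
  have "r \<in> S \<Longrightarrow> set rs \<subseteq> S \<Longrightarrow> foldl (*) r rs \<in> set_power S (length rs)" for r and rs :: "'a list"
  proof (induction rs rule: rev_induct)
    case (snoc x rs)
    then have "foldl (*) r rs * x \<in> set_mul (set_power S (length rs)) (set_power S 0)"
      unfolding set_mul_def by auto
    then show ?case using set_power_add[of S "length rs" 0] by simp
  qed simp
  then show ?thesis using assms by (cases rs) auto
qed

lemma jacobson_radical_mem_iff: "x \<in> jacobson_radical \<longleftrightarrow> (\<forall>y::'a::ring. right_quasi_regular (x * y))"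
  unfolding jacobson_radical_eq right_quasi_regular_def by simp

lemma quasi_regular_jacobson_radical: "quasi_regular_right_ideal (jacobson_radical :: 'a::ring set)"
proof -
  have "jacobson_radical = {x::'a. \<forall>y. right_quasi_regular (x * y)}"
    using jacobson_radical_mem_iff by auto
  then show ?thesis using quasi_regular_right_ideal_greatest(1)[where 'a='a] by simp
qed

lemma jacobson_radical_closed:
  shows "0 \<in> (jacobson_radical :: 'a::ring set)"
    and "x \<in> jacobson_radical \<Longrightarrow> y \<in> jacobson_radical \<Longrightarrow> x + y \<in> (jacobson_radical :: 'a::ring set)"
    and "x \<in> jacobson_radical \<Longrightarrow> - x \<in> (jacobson_radical :: 'a::ring set)"
    and "x \<in> jacobson_radical \<Longrightarrow> x * z \<in> (jacobson_radical :: 'a::ring set)"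
  using quasi_regular_jacobson_radical
  unfolding quasi_regular_right_ideal_def right_ideal_def by auto

lemma add_subgroup_jacobson_radical: "add_subgroup jacobson_radical"
  unfolding add_subgroup_def
  using jacobson_radical_closed by (metis add_uminus_conv_diff)

text \<open>
  Formally \<open>1 + s\<close> is the inverse of \<open>1 - j\<close>, which makes \<open>x = x j + y\<close> solvable as
  \<open>x = y + y s\<close> without a unit.
\<close>

lemma jacobson_quasi_inverse:
  assumes "j \<in> (jacobson_radical :: 'a::ring set)"
  shows "\<exists>s. s = j + j * s"
proof -
  have "right_quasi_regular (- j)"
    using quasi_regular_jacobson_radical jacobson_radical_closed(3)[OF assms]
    unfolding quasi_regular_right_ideal_def by blast
  then obtain s where "- j + s + - j * s = 0" unfolding right_quasi_regular_def by blast
  then have "s = j + j * s" by (simp add: algebra_simps)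
  then show ?thesis by blast
qed

text \<open>
  Nakayama's lemma for a finite set of ring elements, by elimination: the equation for one generator
  is solved for it by a quasi-inverse of its own coefficient, and the result is substituted into the
  equations of the others.
\<close>

lemma radical_multiples_vanish:
  assumes "finite W" "W \<subseteq> lincomb W jacobson_radical"
  shows "W \<subseteq> {0}"
  using assms
proof (induction W)
  case (insert w W)
  let ?J = "jacobson_radical :: 'a set"
  obtain f where f: "w = (\<Sum>u\<in>insert w W. u * f u)" "\<And>u. u \<in> insert w W \<Longrightarrow> f u \<in> ?J"
    using lincombE[of w "insert w W" ?J] insert.prems by blast
  define y where "y = (\<Sum>u\<in>W. u * f u)"
  have w: "w = w * f w + y" using f(1) insert.hyps by (simp add: y_def)
  obtain s where s: "s = f w + f w * s" using jacobson_quasi_inverse[OF f(2)] by blast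
  \<comment> \<open>multiply the equation for \<open>w\<close> by the formal inverse \<open>1 + s\<close> of \<open>1 - f w\<close>\<close>
  have "w * s = w * f w * s + y * s" using w by (metis distrib_right)
  moreover have "w * s = w * f w + w * f w * s" using s by (metis distrib_left mult.assoc)
  ultimately have "y * s = w * f w" by simp
  then have w': "w = y + y * s" using w by (simp add: add.commute)
  define g where "g = (\<lambda>u. f u + f u * s)"
  have g: "g u \<in> ?J" if "u \<in> W" for u
    unfolding g_def using f(2) that by (intro jacobson_radical_closed) auto
  have wg: "w = (\<Sum>u\<in>W. u * g u)"
    using w' unfolding y_def g_def
    by (simp add: distrib_left sum.distrib sum_distrib_right mult.assoc)
  have "W \<subseteq> lincomb W ?J"
  proof
    fix v assume "v \<in> W"
    then have "v \<in> lincomb (insert w W) ?J" using insert.prems by auto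
    then obtain h where h: "v = (\<Sum>u\<in>insert w W. u * h u)" "\<And>u. u \<in> insert w W \<Longrightarrow> h u \<in> ?J"
      by (rule lincombE) blast
    have "v = w * h w + (\<Sum>u\<in>W. u * h u)" using h(1) insert.hyps by simp
    also have "w * h w = (\<Sum>u\<in>W. u * (g u * h w))"
      by (subst wg) (simp add: sum_distrib_right mult.assoc)
    finally have "v = (\<Sum>u\<in>W. u * (g u * h w + h u))"
      by (simp add: distrib_left sum.distrib)
    moreover have "g u * h w + h u \<in> ?J" if "u \<in> W" for u
      using that g h(2) by (intro jacobson_radical_closed) auto
    ultimately show "v \<in> lincomb W ?J"
      using lincombI[of W "\<lambda>u. g u * h w + h u" ?J] by simp
  qed
  then have W: "W \<subseteq> {0}" by (rule insert.IH)
  then have "u * g u = 0" if "u \<in> W" for u using that by auto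
  then have "w = 0" using wg by simp
  then show ?case using W by simp
qed simp

section \<open>Definable sets in a ring\<close>

text \<open>
  A formula in variable 0 is applied to another variable by quantifying over an equal element, which
  avoids substitution. The bound variable 0 shadows any outer use of it.
\<close>

abbreviation at_var :: "('f, 'r, 'a) fm \<Rightarrow> nat \<Rightarrow> ('f, 'r, 'a) fm" where
  "at_var \<phi> i \<equiv> Ex 0 (Conj (Eq (Var 0) (Var i)) \<phi>)"

lemma ring_structure_simps [simp]:
  "fun_arity (ring_structure X) RZero = Some 0"
  "fun_arity (ring_structure X) RUminus = Some 1"
  "fun_arity (ring_structure X) RPlus = Some 2"
  "fun_arity (ring_structure X) RTimes = Some 2"
  "fun_interp (ring_structure X) RZero xs = 0"
  "fun_interp (ring_structure X) RUminus xs = - (xs ! 0)"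
  "fun_interp (ring_structure X) RPlus xs = xs ! 0 + xs ! 1"
  "fun_interp (ring_structure X) RTimes xs = xs ! 0 * xs ! 1"
  unfolding ring_structure_def by simp_all

context
  fixes X :: "('f, 'r, 'a::ring) fo_structure" and A :: "'a set"
begin

abbreviation "def S \<equiv> definable_set (ring_structure X) A S"
abbreviation "cl \<equiv> acl (ring_structure X) A"
abbreviation "loc x \<equiv> locus (ring_structure X) A x"

lemma definable_set_add:
  assumes "def Y" "def Z"
  shows "def (set_add Y Z)"
proof -
  obtain \<phi> \<psi> where f: "\<phi> \<in> formulas1 (ring_structure X) A" "Y = {x. holds1 (ring_structure X) \<phi> x}"
    "\<psi> \<in> formulas1 (ring_structure X) A" "Z = {x. holds1 (ring_structure X) \<psi> x}"
    using assms unfolding definable_set_def by blast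
  define \<chi> where "\<chi> = Ex 1 (Ex 2 (Conj (at_var \<phi> 1) (Conj (at_var \<psi> 2)
    (Eq (Var 0) (Fun RPlus [Var 1, Var 2])))))"
  have "\<chi> \<in> formulas1 (ring_structure X) A"
    using f(1,3) unfolding \<chi>_def formulas1_def by auto
  moreover have "set_add Y Z = {x. holds1 (ring_structure X) \<chi> x}"
    unfolding holds1_def[of _ \<chi>] unfolding \<chi>_def using f
    by (auto simp: sat_iff_holds1 set_add_def)
  ultimately show ?thesis unfolding definable_set_def by blast
qed

lemma definable_set_mul:
  assumes "def Y" "def Z"
  shows "def (set_mul Y Z)"
proof -
  obtain \<phi> \<psi> where f: "\<phi> \<in> formulas1 (ring_structure X) A" "Y = {x. holds1 (ring_structure X) \<phi> x}"
    "\<psi> \<in> formulas1 (ring_structure X) A" "Z = {x. holds1 (ring_structure X) \<psi> x}"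
    using assms unfolding definable_set_def by blast
  define \<chi> where "\<chi> = Ex 1 (Ex 2 (Conj (at_var \<phi> 1) (Conj (at_var \<psi> 2)
    (Eq (Var 0) (Fun RTimes [Var 1, Var 2])))))"
  have "\<chi> \<in> formulas1 (ring_structure X) A"
    using f(1,3) unfolding \<chi>_def formulas1_def by auto
  moreover have "set_mul Y Z = {x. holds1 (ring_structure X) \<chi> x}"
    unfolding holds1_def[of _ \<chi>] unfolding \<chi>_def using f
    by (auto simp: sat_iff_holds1 set_mul_def)
  ultimately show ?thesis unfolding definable_set_def by blast
qed

lemma definable_set_uminus:
  assumes "def Y"
  shows "def (uminus ` Y)"
proof -
  obtain \<phi> where f: "\<phi> \<in> formulas1 (ring_structure X) A" "Y = {x. holds1 (ring_structure X) \<phi> x}"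
    using assms unfolding definable_set_def by blast
  define \<chi> where "\<chi> = Ex 1 (Conj (at_var \<phi> 1) (Eq (Var 0) (Fun RUminus [Var 1])))"
  have "\<chi> \<in> formulas1 (ring_structure X) A"
    using f(1) unfolding \<chi>_def formulas1_def by auto
  moreover have "uminus ` Y = {x. holds1 (ring_structure X) \<chi> x}"
    unfolding holds1_def[of _ \<chi>] unfolding \<chi>_def using f
    by (auto simp: sat_iff_holds1)
  ultimately show ?thesis unfolding definable_set_def by blast
qed

lemma definable_set_zero: "def {0}"
  unfolding definable_set_def
  by (intro bexI[of _ "Eq (Var 0) (Fun RZero [])"]) (auto simp: holds1_def formulas1_def)

lemma definable_left_annihilator:
  assumes "def G"
  shows "def {x. \<forall>g\<in>G. x * g = 0}"
proof -
  obtain \<phi> where f: "\<phi> \<in> formulas1 (ring_structure X) A" "G = {x. holds1 (ring_structure X) \<phi> x}"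
    using assms unfolding definable_set_def by blast
  define \<chi> where "\<chi> = Neg (Ex 1 (Conj (at_var \<phi> 1)
    (Neg (Eq (Fun RTimes [Var 0, Var 1]) (Fun RZero [])))))"
  have "\<chi> \<in> formulas1 (ring_structure X) A"
    using f(1) unfolding \<chi>_def formulas1_def by auto
  moreover have "{x. \<forall>g\<in>G. x * g = 0} = {x. holds1 (ring_structure X) \<chi> x}"
    unfolding holds1_def[of _ \<chi>] unfolding \<chi>_def using f
    by (auto simp: sat_iff_holds1)
  ultimately show ?thesis unfolding definable_set_def by blast
qed

lemma definable_right_annihilator:
  assumes "def G"
  shows "def {x. \<forall>g\<in>G. g * x = 0}"
proof -
  obtain \<phi> where f: "\<phi> \<in> formulas1 (ring_structure X) A" "G = {x. holds1 (ring_structure X) \<phi> x}"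
    using assms unfolding definable_set_def by blast
  define \<chi> where "\<chi> = Neg (Ex 1 (Conj (at_var \<phi> 1)
    (Neg (Eq (Fun RTimes [Var 1, Var 0]) (Fun RZero [])))))"
  have "\<chi> \<in> formulas1 (ring_structure X) A"
    using f(1) unfolding \<chi>_def formulas1_def by auto
  moreover have "{x. \<forall>g\<in>G. g * x = 0} = {x. holds1 (ring_structure X) \<chi> x}"
    unfolding holds1_def[of _ \<chi>] unfolding \<chi>_def using f
    by (auto simp: sat_iff_holds1)
  ultimately show ?thesis unfolding definable_set_def by blast
qed

lemma definable_jacobson_radical: "def jacobson_radical"
proof -
  let ?xy = "Fun RTimes [Var 0, Var 1]"
  define \<chi> :: "('f ring_fun, 'r, 'a) fm" where "\<chi> = Neg (Ex 1 (Neg (Ex 2 (Eq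
    (Fun RPlus [Fun RPlus [?xy, Var 2], Fun RTimes [?xy, Var 2]]) (Fun RZero [])))))"
  have "\<chi> \<in> formulas1 (ring_structure X) A"
    unfolding \<chi>_def formulas1_def by auto
  moreover have "jacobson_radical = {x. holds1 (ring_structure X) \<chi> x}"
    by (auto simp: \<chi>_def holds1_def jacobson_radical_eq)
  ultimately show ?thesis unfolding definable_set_def by blast
qed

lemma acl_add:
  assumes "x \<in> cl" "y \<in> cl"
  shows "x + y \<in> cl"
proof -
  obtain Y Z where "def Y" "finite Y" "x \<in> Y" "def Z" "finite Z" "y \<in> Z"
    using assms unfolding mem_acl_iff by auto
  then have "def (set_add Y Z)" "finite (set_add Y Z)" "x + y \<in> set_add Y Z"
    using definable_set_add finite_set_add by (auto simp: set_add_def)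
  then show ?thesis unfolding mem_acl_iff by auto
qed

lemma acl_mult:
  assumes "x \<in> cl" "y \<in> cl"
  shows "x * y \<in> cl"
proof -
  obtain Y Z where "def Y" "finite Y" "x \<in> Y" "def Z" "finite Z" "y \<in> Z"
    using assms unfolding mem_acl_iff by auto
  then have "def (set_mul Y Z)" "finite (set_mul Y Z)" "x * y \<in> set_mul Y Z"
    using definable_set_mul finite_set_mul by (auto simp: set_mul_def)
  then show ?thesis unfolding mem_acl_iff by auto
qed

lemma acl_uminus:
  assumes "x \<in> cl"
  shows "- x \<in> cl"
proof -
  obtain Y where "def Y" "finite Y" "x \<in> Y" using assms unfolding mem_acl_iff by auto
  then have "def (uminus ` Y)" "finite (uminus ` Y)" "- x \<in> uminus ` Y"
    using definable_set_uminus by auto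
  then show ?thesis unfolding mem_acl_iff by auto
qed

lemma acl_zero: "0 \<in> cl"
  unfolding mem_acl_iff by (intro exI[of _ "{0}"]) (simp add: definable_set_zero)

lemma acl_base: "a \<in> A \<Longrightarrow> a \<in> cl"
  unfolding mem_acl_iff by (intro exI[of _ "{a}"]) (simp add: definable_set_singleton)

section \<open>The chain condition on traces\<close>

text \<open>
  If the traces decrease strictly at every step, choose witnesses \<open>b n\<close> in \<open>acl(A) \<inter> H n\<close> outside
  \<open>H (Suc n)\<close>. Witnesses with distinct indices are incongruent modulo every later subgroup, so
  that for \<open>d \<in> D\<close> the elements \<open>d + b j\<close> eventually outnumber the cosets covered by \<open>D\<close>. One of
  them lies outside \<open>D + H m'\<close>, and its locus provides the second half of \<open>D + H m\<close>.
\<close>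

lemma trace_chain_condition:
  assumes small: "countable (complete_1types (ring_structure X) A)"
    and definable: "\<And>n. def (H n)"
    and subgroup: "\<And>n. add_subgroup (H n)"
    and decreasing: "\<And>n. H (Suc n) \<subseteq> H n"
  shows "\<exists>n. cl \<inter> H n \<subseteq> H (Suc n)"
proof (rule ccontr)
  assume "\<not> ?thesis"
  then have "\<forall>n. \<exists>b. b \<in> cl \<and> b \<in> H n \<and> b \<notin> H (Suc n)" by blast
  then obtain b where b: "\<And>n. b n \<in> cl" "\<And>n. b n \<in> H n" "\<And>n. b n \<notin> H (Suc n)"
    by metis
  have anti: "m \<le> n \<Longrightarrow> H n \<subseteq> H m" for m n
    using lift_Suc_antimono_le[of H, OF decreasing] by blast
  have zero: "0 \<in> H n" for n using subgroup unfolding add_subgroup_def by blast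
  have diff: "x \<in> H n \<Longrightarrow> y \<in> H n \<Longrightarrow> x - y \<in> H n" for x y n
    using subgroup unfolding add_subgroup_def by blast
  have apart: "b i - b j \<notin> H n" if "i < j" "j < n" for i j n
  proof
    assume "b i - b j \<in> H n"
    then have "b i - b j \<in> H (Suc i)" using anti[of "Suc i" n] that by auto
    moreover have "b j \<in> H (Suc i)" using b(2)[of j] anti[of "Suc i" j] that by auto
    ultimately have "(b i - b j) + b j \<in> H (Suc i)" by (rule add_subgroup_add[OF subgroup])
    then show False using b(3)[of i] by simp
  qed
  define \<U> where "\<U> = {set_add D (H m) | D m. finite D \<and> D \<noteq> {} \<and> def D}"
  have "uncountable (complete_1types (ring_structure X) A)"
  proof (rule uncountable_types_of_splitting_family)
    show "set_add {0} (H 0) \<in> \<U>" unfolding \<U>_def using definable_set_zero by blast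
    show "def U" if "U \<in> \<U>" for U
      using that definable_set_add definable unfolding \<U>_def by blast
    show "U \<noteq> {}" if "U \<in> \<U>" for U
      using that zero unfolding \<U>_def set_add_def by blast
    show "\<exists>V\<in>\<U>. \<exists>W\<in>\<U>. V \<subseteq> U \<and> W \<subseteq> U \<and> V \<inter> W = {}" if in_family: "U \<in> \<U>" for U
    proof -
      obtain D m where U: "U = set_add D (H m)" and D: "finite D" "D \<noteq> {}" "def D"
        using in_family unfolding \<U>_def by blast
      obtain d where d: "d \<in> D" using D(2) by blast
      \<comment> \<open>below \<open>b m, \<dots>, b (m + card D)\<close>, which are one more than \<open>D\<close> has elements\<close>
      define m' where "m' = m + card D + 1"
      have "\<exists>j\<le>card D. d + b (m + j) \<notin> set_add D (H m')"
      proof (rule ccontr)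
        assume "\<not> ?thesis"
        then have "\<forall>j\<in>{..card D}. \<exists>c. c \<in> D \<and> d + b (m + j) - c \<in> H m'"
          unfolding set_add_def by force
        then obtain c where c: "\<And>j. j \<le> card D \<Longrightarrow> c j \<in> D"
          "\<And>j. j \<le> card D \<Longrightarrow> d + b (m + j) - c j \<in> H m'"
          by (metis atMost_iff)
        have "card (c ` {..card D}) \<le> card D" using c(1) D(1) by (intro card_mono) auto
        then have "\<not> inj_on c {..card D}" using card_image by fastforce
        then obtain i j where ij: "i \<le> card D" "j \<le> card D" "i < j" "c i = c j"
          unfolding inj_on_def by (metis atMost_iff linorder_neqE_nat)
        have "(d + b (m + i) - c i) - (d + b (m + j) - c j) \<in> H m'"
          by (intro diff c(2) ij)
        then have "b (m + i) - b (m + j) \<in> H m'" using ij(4) by simp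
        then show False using apart[of "m + i" "m + j" m'] ij unfolding m'_def by simp
      qed
      then obtain j where j: "d + b (m + j) \<notin> set_add D (H m')" by blast
      define g where "g = d + b (m + j)"
      have "d \<in> cl" using d D unfolding mem_acl_iff by blast
      then have g_cl: "g \<in> cl" unfolding g_def by (intro acl_add b)
      have "b (m + j) \<in> H m" using b(2)[of "m + j"] anti[of m "m + j"] by auto
      then have g: "g \<in> set_add D (H m) - set_add D (H m')"
        using d j unfolding g_def set_add_def by blast
      have E: "loc g \<subseteq> set_add D (H m) - set_add D (H m')"
        by (intro locus_subset g definable_set_Diff definable_set_add D definable)
      have sub: "H m' \<subseteq> H m" by (rule anti) (simp add: m'_def)
      have absorb: "set_add (set_add D (H m)) (H m') \<subseteq> set_add D (H m)"
      proof
        fix u assume "u \<in> set_add (set_add D (H m)) (H m')"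
        then obtain x y z where u: "u = x + y + z" and xyz: "x \<in> D" "y \<in> H m" "z \<in> H m'"
          unfolding set_add_def by blast
        have "y + z \<in> H m" using sub xyz by (intro add_subgroup_add[OF subgroup]) auto
        then show "u \<in> set_add D (H m)" using u xyz(1) unfolding set_add_def by (auto simp: add.assoc)
      qed
      have "set_add D (H m') \<subseteq> U" unfolding U using sub by (intro set_add_mono) auto
      moreover have "set_add (loc g) (H m') \<subseteq> U"
        unfolding U using E by (intro subset_trans[OF set_add_mono absorb]) auto
      moreover have "set_add D (H m') \<inter> set_add (loc g) (H m') = {}"
      proof (rule equals0I)
        fix u assume "u \<in> set_add D (H m') \<inter> set_add (loc g) (H m')"
        then obtain x y e z where "x \<in> D" "y \<in> H m'" "u = x + y"
          and e: "e \<in> loc g" and "z \<in> H m'" "u = e + z"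
          unfolding set_add_def by auto
        then have "y - z \<in> H m'" "e = x + (y - z)" using diff by (auto simp: algebra_simps)
        then have "e \<in> set_add D (H m')" using \<open>x \<in> D\<close> unfolding set_add_def by auto
        then show False using E e by auto
      qed
      moreover have "set_add D (H m') \<in> \<U>" using D unfolding \<U>_def by blast
      moreover have "set_add (loc g) (H m') \<in> \<U>"
        unfolding \<U>_def using locus_of_algebraic[OF g_cl] mem_locus[of g] by auto
      ultimately show ?thesis by blast
    qed
  qed
  then show False using small by blast
qed


text \<open>
  A finite definable subset of \<open>S\<close> that does not determine the annihilator of \<open>S\<close> can be enlarged by
  the locus of a point of \<open>S\<close> so that the trace of its annihilator shrinks; this cannot go on
  forever. The operation \<open>m\<close> is multiplication in either order, so that both kinds of annihilator
  are covered.
\<close>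

lemma annihilator_finitely_determined:
  fixes m :: "'a \<Rightarrow> 'a \<Rightarrow> 'a"
  assumes small: "countable (complete_1types (ring_structure X) A)"
    and additive: "\<And>x y g. m (x - y) g = m x g - m y g"
    and definable: "\<And>G. def G \<Longrightarrow> def {x. \<forall>g\<in>G. m x g = 0}"
    and algebraic: "S \<subseteq> cl"
    and invariant: "\<And>s. s \<in> S \<Longrightarrow> loc s \<subseteq> S"
  shows "\<exists>G. finite G \<and> G \<subseteq> S \<and> (\<forall>x\<in>cl. (\<forall>g\<in>G. m x g = 0) \<longrightarrow> (\<forall>s\<in>S. m x s = 0))"
proof (rule ccontr)
  assume neg: "\<not> ?thesis"
  define P where "P = (\<lambda>G. finite G \<and> def G \<and> G \<subseteq> S)"
  define Q where "Q = (\<lambda>G G'. G \<subseteq> G' \<and> (\<exists>x\<in>cl. (\<forall>g\<in>G. m x g = 0) \<and> \<not> (\<forall>g\<in>G'. m x g = 0)))"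
  have "\<exists>G. \<forall>n. P (G n) \<and> Q (G n) (G (Suc n))"
  proof (rule dependent_nat_choice)
    show "\<exists>G. P G" unfolding P_def using definable_set_empty by blast
  next
    fix G :: "'a set" and n :: nat
    assume G: "P G"
    then obtain x s where xs: "x \<in> cl" "\<forall>g\<in>G. m x g = 0" "s \<in> S" "m x s \<noteq> 0"
      using neg unfolding P_def by meson
    have s: "s \<in> cl" using xs(3) algebraic by auto
    have "P (G \<union> loc s)"
      using G locus_of_algebraic[OF s] invariant[OF xs(3)] definable_set_Un unfolding P_def by auto
    moreover have "Q G (G \<union> loc s)"
      unfolding Q_def using xs mem_locus[of s] by (intro conjI bexI[of _ x]) auto
    ultimately show "\<exists>G'. P G' \<and> Q G G'" by auto
  qed
  then obtain G where P: "\<And>n. P (G n)" and Q: "\<And>n. Q (G n) (G (Suc n))" by auto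
  define H where "H = (\<lambda>n. {x. \<forall>g\<in>G n. m x g = 0})"
  have zero: "m 0 g = 0" for g using additive[of 0 0 g] by simp
  have "\<exists>n. cl \<inter> H n \<subseteq> H (Suc n)"
  proof (rule trace_chain_condition[OF small])
    show "def (H n)" for n unfolding H_def using P definable unfolding P_def by blast
    show "add_subgroup (H n)" for n unfolding H_def add_subgroup_def by (simp add: zero additive)
    show "H (Suc n) \<subseteq> H n" for n using Q[of n] unfolding Q_def H_def by auto
  qed
  then show False using Q unfolding Q_def H_def by blast
qed

section \<open>Local nilpotency of the radical\<close>

lemma definable_lincomb:
  assumes "finite W" "W \<subseteq> A" "def Y"
  shows "def (lincomb W Y)"
  using assms
proof (induction W)
  case empty
  then show ?case using definable_set_zero by (simp add: lincomb_def)
next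
  case (insert w W)
  have "def {w}" using insert.prems by (intro definable_set_singleton) auto
  then show ?case
    using insert by (simp add: lincomb_insert definable_set_add definable_set_mul)
qed

text \<open>
  The chain starts with the radical and not with the whole ring: then \<open>D\<^sup>n\<^sup>+\<^sup>1\<close> lies in \<open>H n\<close>, whereas
  \<open>H (Suc n)\<close> consists of multiples of \<open>D\<^sup>n\<^sup>+\<^sup>1\<close> with coefficients in the radical. Where the
  traces agree, the coefficients can thus be taken quasi-regular.
\<close>

lemma finite_subset_of_radical_nilpotent:
  assumes small: "countable (complete_1types (ring_structure X) A)"
    and D: "finite D" "D \<subseteq> A" "D \<subseteq> jacobson_radical"
  shows "\<exists>n. set_power D n \<subseteq> {0}"
proof -
  let ?J = "jacobson_radical :: 'a set"
  define H where "H = rec_nat ?J (\<lambda>_. lincomb D)"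
  have H_simps: "H 0 = ?J" "H (Suc n) = lincomb D (H n)" for n unfolding H_def by simp_all
  have subgroup: "add_subgroup (H n)" for n
    by (induction n) (simp_all add: H_simps add_subgroup_jacobson_radical add_subgroup_lincomb)
  have decreasing: "H (Suc n) \<subseteq> H n" for n
  proof (induction n)
    case 0
    show ?case
    proof
      fix x assume "x \<in> H (Suc 0)"
      then obtain f where "x = (\<Sum>d\<in>D. d * f d)" unfolding H_simps by (rule lincombE) blast
      then show "x \<in> H 0"
        unfolding H_simps using D(3)
        by (auto intro!: add_subgroup_sum[OF add_subgroup_jacobson_radical] jacobson_radical_closed(4))
    qed
  next
    case (Suc n)
    then show ?case unfolding H_simps(2) by (intro lincomb_mono) (simp add: H_simps)
  qed
  have definable: "def (H n)" for n
    by (induction n) (simp_all add: H_simps definable_jacobson_radical definable_lincomb D)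
  obtain n where n: "cl \<inter> H n \<subseteq> H (Suc n)"
    using trace_chain_condition[of H, OF small definable subgroup decreasing] by blast
  have in_cl: "set_power D n \<subseteq> cl" for n
    using D(2) by (induction n) (auto simp: set_mul_def intro: acl_base acl_mult)
  have in_H: "set_power D n \<subseteq> H n" for n
  proof (induction n)
    case 0
    then show ?case using D(3) by (simp add: H_simps)
  next
    case (Suc n)
    have "0 \<in> H n" using subgroup[of n] unfolding add_subgroup_def by simp
    then show ?case using Suc mult_mem_lincomb[OF D(1)] by (auto simp: H_simps set_mul_def)
  qed
  have span: "H (Suc n) \<subseteq> lincomb (set_power D n) ?J" for n
  proof (induction n)
    case (Suc n)
    let ?W = "set_power D (Suc n)"
    have fin: "finite ?W" by (rule finite_set_power[OF D(1)])
    have sub: "add_subgroup (lincomb ?W ?J)"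
      by (rule add_subgroup_lincomb[OF add_subgroup_jacobson_radical])
    show ?case
    proof
      fix x assume "x \<in> H (Suc (Suc n))"
      then obtain f where f: "x = (\<Sum>d\<in>D. d * f d)" "\<And>d. d \<in> D \<Longrightarrow> f d \<in> H (Suc n)"
        unfolding H_simps(2)[of "Suc n"] by (rule lincombE) blast
      have "d * f d \<in> lincomb ?W ?J" if d: "d \<in> D" for d
      proof -
        have "f d \<in> lincomb (set_power D n) ?J" using f(2)[OF d] Suc by auto
        then obtain g where g: "f d = (\<Sum>u\<in>set_power D n. u * g u)"
          "\<And>u. u \<in> set_power D n \<Longrightarrow> g u \<in> ?J"
          by (rule lincombE) blast
        have "d * f d = (\<Sum>u\<in>set_power D n. d * u * g u)"
          unfolding g(1) by (simp add: sum_distrib_left mult.assoc)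
        also have "\<dots> \<in> lincomb ?W ?J"
        proof (rule add_subgroup_sum[OF sub])
          fix u assume u: "u \<in> set_power D n"
          then have "d * u \<in> ?W" using d by (auto simp: set_mul_def)
          then show "d * u * g u \<in> lincomb ?W ?J"
            by (rule mult_mem_lincomb[OF fin _ g(2)[OF u] jacobson_radical_closed(1)])
        qed
        finally show ?thesis .
      qed
      then show "x \<in> lincomb ?W ?J" unfolding f(1) by (rule add_subgroup_sum[OF sub])
    qed
  qed (simp add: H_simps)
  have "set_power D n \<subseteq> lincomb (set_power D n) ?J"
    using in_cl[of n] in_H[of n] n span[of n] by auto
  then have "set_power D n \<subseteq> {0}" by (rule radical_multiples_vanish[OF finite_set_power[OF D(1)]])
  then show ?thesis by blast
qed

section \<open>Annihilators of the powers of the closure\<close>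

abbreviation "\<Gamma> \<equiv> cl \<inter> (jacobson_radical :: 'a set)"


lemma mult_mem_radical_closure: "x \<in> \<Gamma> \<Longrightarrow> y \<in> \<Gamma> \<Longrightarrow> x * y \<in> \<Gamma>"
  by (elim IntE, intro IntI acl_mult jacobson_radical_closed(4))

lemma subring_radical_closure: "subring \<Gamma>"
  unfolding subring_def
  by (intro conjI ballI; (elim IntE)?;
    intro IntI acl_zero acl_add acl_uminus acl_mult jacobson_radical_closed)

text \<open>
  Equivalently, \<open>S\<close> is a union of finite \<open>A\<close>-definable subsets of \<open>\<Gamma>\<close>. It may well be infinite
  and not definable.
\<close>

definition invariant :: "'a set \<Rightarrow> bool" where
  "invariant S \<longleftrightarrow> S \<subseteq> \<Gamma> \<and> (\<forall>s\<in>S. loc s \<subseteq> S)"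

lemma definable_locus: "x \<in> \<Gamma> \<Longrightarrow> def (loc x)"
  by (simp add: locus_of_algebraic)

lemma invariant_radical_closure: "invariant \<Gamma>"
  unfolding invariant_def
proof (intro conjI ballI order_refl)
  fix x assume x: "x \<in> \<Gamma>"
  have "finite (loc x)" "def (loc x)" using x by (simp_all add: locus_of_algebraic)
  then have "loc x \<subseteq> cl" by (auto simp: mem_acl_iff intro!: exI[of _ "loc x"])
  moreover have "loc x \<subseteq> jacobson_radical"
    using x by (intro locus_subset definable_jacobson_radical) simp
  ultimately show "loc x \<subseteq> \<Gamma>" by simp
qed

lemma invariant_set_mul:
  assumes S: "invariant S" and T: "invariant T"
  shows "invariant (set_mul S T)"
  unfolding invariant_def
proof (intro conjI ballI)
  show "set_mul S T \<subseteq> \<Gamma>"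
    using S T unfolding invariant_def set_mul_def by (auto intro: acl_mult jacobson_radical_closed)
  fix x assume "x \<in> set_mul S T"
  then obtain s t where st: "s \<in> S" "t \<in> T" "x = s * t" unfolding set_mul_def by blast
  then have "s \<in> \<Gamma>" "t \<in> \<Gamma>" using S T unfolding invariant_def by auto
  then have "def (set_mul (loc s) (loc t))"
    by (intro definable_set_mul definable_locus)
  moreover have "x \<in> set_mul (loc s) (loc t)"
    unfolding st(3) by (intro set_mulI mem_locus)
  ultimately have "loc x \<subseteq> set_mul (loc s) (loc t)" by (rule locus_subset)
  also have "\<dots> \<subseteq> set_mul S T"
    using st(1,2) S T unfolding invariant_def by (intro set_mul_mono) auto
  finally show "loc x \<subseteq> set_mul S T" .
qed

lemma invariant_set_power: "invariant (set_power \<Gamma> n)"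
  by (induction n) (simp_all add: invariant_radical_closure invariant_set_mul)

lemma set_power_radical_closure_subset: "set_power \<Gamma> n \<subseteq> \<Gamma>"
  using invariant_set_power[of n] unfolding invariant_def by simp

definition power_annihilator :: "nat \<Rightarrow> 'a set" where
  "power_annihilator n = {x \<in> \<Gamma>. \<forall>p\<in>set_power \<Gamma> n. x * p = 0}"

text \<open>
  The annihilator of \<open>\<Gamma>\<^sup>n\<^sup>+\<^sup>1\<close> is an intersection of annihilators of loci, each of which is
  definable and hence contains the locus of any of its points.
\<close>

lemma invariant_power_annihilator: "invariant (power_annihilator n)"
  unfolding invariant_def
proof (intro conjI ballI)
  show "power_annihilator n \<subseteq> \<Gamma>" unfolding power_annihilator_def by (rule Collect_restrict)
  fix x assume x: "x \<in> power_annihilator n"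
  then have "x \<in> \<Gamma>" unfolding power_annihilator_def by simp
  have "z * p = 0" if z: "z \<in> loc x" and p: "p \<in> set_power \<Gamma> n" for z p
  proof -
    have sub: "loc p \<subseteq> set_power \<Gamma> n" and "p \<in> \<Gamma>"
      using invariant_set_power[of n] p unfolding invariant_def by auto
    have "def {y. \<forall>g\<in>loc p. y * g = 0}"
      by (intro definable_left_annihilator definable_locus \<open>p \<in> \<Gamma>\<close>)
    moreover have "x \<in> {y. \<forall>g\<in>loc p. y * g = 0}"
      using x sub unfolding power_annihilator_def by auto
    ultimately have "loc x \<subseteq> {y. \<forall>g\<in>loc p. y * g = 0}" by (rule locus_subset)
    then have "\<forall>g\<in>loc p. z * g = 0" using z by auto
    then show ?thesis by (rule bspec) (rule mem_locus)
  qed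
  moreover have "loc x \<subseteq> \<Gamma>"
    using \<open>x \<in> \<Gamma>\<close> invariant_radical_closure unfolding invariant_def by blast
  ultimately show "loc x \<subseteq> power_annihilator n" unfolding power_annihilator_def by auto
qed

lemma power_annihilator_mono:
  assumes "m \<le> n"
  shows "power_annihilator m \<subseteq> power_annihilator n"
proof -
  have "power_annihilator n \<subseteq> power_annihilator (Suc n)" for n
  proof
    fix x assume x: "x \<in> power_annihilator n"
    have "x * q = 0" if q: "q \<in> set_power \<Gamma> (Suc n)" for q
    proof -
      obtain p r where "p \<in> set_power \<Gamma> n" "q = p * r"
        using q set_power_add[of \<Gamma> n 0] unfolding set_mul_def by auto
      then show ?thesis using x unfolding power_annihilator_def by (simp flip: mult.assoc)
    qed
    then show "x \<in> power_annihilator (Suc n)" using x unfolding power_annihilator_def by simp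
  qed
  then show ?thesis using assms by (rule lift_Suc_mono_le)
qed

text \<open>
  The ascending chain is controlled from the other side. The right annihilator of the union of the
  chain is that of a finite subset, which is contained in a single member \<open>L N\<close>; as \<open>\<Gamma>\<^sup>N\<^sup>+\<^sup>1\<close> is
  annihilated by \<open>L N\<close>, it is annihilated by the union.
\<close>

lemma power_annihilator_stabilises:
  assumes small: "countable (complete_1types (ring_structure X) A)"
  shows "\<exists>N. \<forall>n. power_annihilator n \<subseteq> power_annihilator N"
proof -
  let ?S = "\<Union>n. power_annihilator n"
  have "\<exists>G. finite G \<and> G \<subseteq> ?S \<and>
      (\<forall>y\<in>cl. (\<forall>g\<in>G. g * y = 0) \<longrightarrow> (\<forall>s\<in>?S. s * y = 0))"
  proof (rule annihilator_finitely_determined[where m = "\<lambda>y g. g * y", OF small])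
    show "?S \<subseteq> cl" unfolding power_annihilator_def by auto
    show "loc s \<subseteq> ?S" if "s \<in> ?S" for s
      using that invariant_power_annihilator unfolding invariant_def by blast
    show "def {y. \<forall>g\<in>G. g * y = 0}" if "def G" for G
      by (rule definable_right_annihilator[OF that])
  qed (rule right_diff_distrib)
  then obtain G where G: "finite G" "G \<subseteq> ?S"
    and determined: "\<forall>y\<in>cl. (\<forall>g\<in>G. g * y = 0) \<longrightarrow> (\<forall>s\<in>?S. s * y = 0)"
    by (elim exE conjE)
  have "\<exists>N. G \<subseteq> power_annihilator N" using G
  proof (induction G)
    case (insert g G)
    then obtain m n where mn: "G \<subseteq> power_annihilator m" "g \<in> power_annihilator n" by auto
    then have "insert g G \<subseteq> power_annihilator (max m n)"
      using power_annihilator_mono[of m "max m n"] power_annihilator_mono[of n "max m n"] by auto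
    then show ?case by (rule exI)
  qed simp
  then obtain N where N: "G \<subseteq> power_annihilator N" by (elim exE)
  have "x \<in> power_annihilator N" if x: "x \<in> power_annihilator n" for x n
  proof -
    have "x * p = 0" if p: "p \<in> set_power \<Gamma> N" for p
    proof -
      have "p \<in> cl" using p set_power_radical_closure_subset[of N] by auto
      moreover have "\<forall>g\<in>G. g * p = 0" using N p unfolding power_annihilator_def by auto
      ultimately have "\<forall>s\<in>?S. s * p = 0" using determined by simp
      then show ?thesis using x by auto
    qed
    then show ?thesis using x unfolding power_annihilator_def by simp
  qed
  then show ?thesis by (intro exI[of _ N]) auto
qed

text \<open>
  Split each element of a finite set determining the annihilator of \<open>\<Gamma>\<^sup>2\<^sup>N\<^sup>+\<^sup>2\<close> as a product
  \<open>f p\<close> of two elements of \<open>\<Gamma>\<^sup>N\<^sup>+\<^sup>1\<close>, and let \<open>F\<close> consist of the first halves. If \<open>x f\<close> annihilates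
  \<open>\<Gamma>\<^sup>N\<^sup>+\<^sup>1\<close> for all \<open>f\<close>, then \<open>x\<close> annihilates \<open>\<Gamma>\<^sup>2\<^sup>N\<^sup>+\<^sup>2\<close>, and by stability already
  \<open>\<Gamma>\<^sup>N\<^sup>+\<^sup>1\<close>.
\<close>

lemma finite_set_detecting_power_annihilator:
  assumes small: "countable (complete_1types (ring_structure X) A)"
    and stable: "\<And>n. power_annihilator n \<subseteq> power_annihilator N"
  shows "\<exists>F. finite F \<and> F \<subseteq> \<Gamma> \<and>
    (\<forall>x\<in>\<Gamma>. (\<forall>f\<in>F. x * f \<in> power_annihilator N) \<longrightarrow> x \<in> power_annihilator N)"
proof -
  let ?T = "set_power \<Gamma> (Suc (N + N))"
  have "\<exists>G. finite G \<and> G \<subseteq> ?T \<and> (\<forall>x\<in>cl. (\<forall>g\<in>G. x * g = 0) \<longrightarrow> (\<forall>s\<in>?T. x * s = 0))"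
  proof (rule annihilator_finitely_determined[where m = "(*)", OF small])
    show "?T \<subseteq> cl" using set_power_radical_closure_subset[of "Suc (N + N)"] by auto
    show "loc s \<subseteq> ?T" if "s \<in> ?T" for s
      using that invariant_set_power[of "Suc (N + N)"] unfolding invariant_def by blast
    show "def {x. \<forall>g\<in>G. x * g = 0}" if "def G" for G
      by (rule definable_left_annihilator[OF that])
  qed (rule left_diff_distrib)
  then obtain G where G: "finite G" "G \<subseteq> ?T"
    and determined: "\<forall>x\<in>cl. (\<forall>g\<in>G. x * g = 0) \<longrightarrow> (\<forall>s\<in>?T. x * s = 0)"
    by (elim exE conjE)
  have "\<forall>g\<in>G. \<exists>f. f \<in> set_power \<Gamma> N \<and> (\<exists>p\<in>set_power \<Gamma> N. g = f * p)"
  proof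
    fix g assume "g \<in> G"
    then have "g \<in> set_mul (set_power \<Gamma> N) (set_power \<Gamma> N)"
      using G(2) unfolding set_power_add by (rule rev_subsetD)
    then show "\<exists>f. f \<in> set_power \<Gamma> N \<and> (\<exists>p\<in>set_power \<Gamma> N. g = f * p)"
      unfolding set_mul_def by blast
  qed
  from bchoice[OF this] obtain first where first:
    "\<forall>g\<in>G. first g \<in> set_power \<Gamma> N \<and> (\<exists>p\<in>set_power \<Gamma> N. g = first g * p)" by (elim exE)
  have "x \<in> power_annihilator N"
    if x: "x \<in> \<Gamma>" "\<forall>f\<in>first ` G. x * f \<in> power_annihilator N" for x
  proof -
    have "x * g = 0" if g: "g \<in> G" for g
    proof -
      obtain p where p: "p \<in> set_power \<Gamma> N" "g = first g * p" using first g by auto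
      have "x * first g * p = 0" using x(2) g p(1) unfolding power_annihilator_def by simp
      then have "x * (first g * p) = 0" by (simp only: mult.assoc)
      then show ?thesis using p(2) by simp
    qed
    then have "\<forall>s\<in>?T. x * s = 0" using determined x(1) by simp
    then have "x \<in> power_annihilator (Suc (N + N))" using x(1) unfolding power_annihilator_def by simp
    then show ?thesis using stable by auto
  qed
  moreover have "first ` G \<subseteq> \<Gamma>" using first set_power_radical_closure_subset[of N] by auto
  ultimately show ?thesis using G(1) by (intro exI[of _ "first ` G"]) simp
qed

end

section \<open>Nilpotency of the closure\<close>

theorem proposition5p11:
  fixes X :: "('f, 'r, 'a::ring) fo_structure"
    and as :: "'a list"
  assumes "weakly_small (ring_structure X)"
    and "set as \<subseteq> jacobson_radical"
  shows "nilpotent_subring (acl (ring_structure X) (set as) \<inter> jacobson_radical)"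
proof -
  let ?L = "power_annihilator X (set as)"
  define \<Gamma> where "\<Gamma> = acl (ring_structure X) (set as) \<inter> jacobson_radical"
  have small: "countable (complete_1types (ring_structure X) D)" if "finite D" for D
    using assms(1) that unfolding weakly_small_def by blast
  obtain N where stable: "\<forall>n. ?L n \<subseteq> ?L N"
    using power_annihilator_stabilises[OF small, of "set as"] by auto
  have "\<exists>F. finite F \<and> F \<subseteq> \<Gamma> \<and> (\<forall>x\<in>\<Gamma>. (\<forall>f\<in>F. x * f \<in> ?L N) \<longrightarrow> x \<in> ?L N)"
    unfolding \<Gamma>_def
    by (rule finite_set_detecting_power_annihilator) (simp_all add: small stable)
  then obtain F where F: "finite F" "F \<subseteq> \<Gamma>"
    and detect: "\<forall>x\<in>\<Gamma>. (\<forall>f\<in>F. x * f \<in> ?L N) \<longrightarrow> x \<in> ?L N"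
    by (elim exE conjE)
  have cancel: "x \<in> ?L N" if "x \<in> \<Gamma>" "\<forall>f\<in>F. x * f \<in> ?L N" for x
    using detect that by simp
  have cancel_power: "x \<in> ?L N" if "x \<in> \<Gamma>" "\<forall>f\<in>set_power F k. x * f \<in> ?L N" for x k
    using that
  proof (induction k arbitrary: x)
    case 0
    then show ?case using cancel by simp
  next
    case (Suc k)
    show ?case
    proof (rule cancel[OF Suc.prems(1)], intro ballI)
      fix f assume f: "f \<in> F"
      show "x * f \<in> ?L N"
      proof (rule Suc.IH)
        show "x * f \<in> \<Gamma>"
          using f F(2) Suc.prems(1) mult_mem_radical_closure[of x X "set as" f] unfolding \<Gamma>_def by auto
        show "\<forall>t\<in>set_power F k. x * f * t \<in> ?L N"
          using f Suc.prems(2) by (auto simp: set_mul_def mult.assoc)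
      qed
    qed
  qed
  obtain k where k: "set_power F k \<subseteq> {0}"
    using finite_subset_of_radical_nilpotent[OF small[OF F(1)] F(1) order_refl] F(2)
    unfolding \<Gamma>_def by auto
  have "subring \<Gamma>" unfolding \<Gamma>_def by (rule subring_radical_closure)
  then have zero: "0 \<in> ?L N" unfolding power_annihilator_def \<Gamma>_def subring_def by simp
  \<comment> \<open>the hypothesis of \<open>cancel_power\<close> holds trivially, the products being zero\<close>
  have "x \<in> ?L N" if "x \<in> \<Gamma>" for x
    by (rule cancel_power[OF that, of k]) (use k zero in auto)
  then have "set_power \<Gamma> (Suc N) \<subseteq> {0}"
    unfolding power_annihilator_def \<Gamma>_def by (auto simp: set_mul_def)
  then have "ring_prod rs = 0" if "length rs = Suc (Suc N)" "set rs \<subseteq> \<Gamma>" for rs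
    using ring_prod_mem_set_power[OF that] by auto
  then show ?thesis
    unfolding nilpotent_subring_def \<Gamma>_def[symmetric] using \<open>subring \<Gamma>\<close>
    by (intro conjI exI[of _ "Suc (Suc N)"]) auto
qed

end
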